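(* Let $m\ge 0$ be an integer and let $G$ be a graph on $n$ vertices with $n\ge 8m$. Let $c$ be a proper edge coloring of $G$ with total color degree $\hat d(G)\ge 2mn$. Then $G$ contains a rainbow matching (with respect to $c$) of size $m$.
   Context: All graphs are finite and simple. An edge coloring $c:E(G)\to[r]$ is proper if any two distinct edges sharing a vertex receive different colors. For a vertex $v$, the color degree $\hat d(v)$ is the number of distinct colors that $c$ assigns to edges incident to $v$. The total color degree of $G$ is $\hat d(G)=\sum_{v\in V(G)}\hat d(v)$. A matching of size $k$ is a set of $k$ pairwise vertex-disjoint edges; it is rainbow if its edges receive pairwise distinct colors. *)

theory Defs
  imports Main "HOL-Library.Disjoint_Sets"
begin

definition simple_graph :: "'v set \<Rightarrow> 'v set set \<Rightarrow> bool" where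
  "simple_graph V E \<longleftrightarrow> finite V \<and> (\<forall>e\<in>E. e \<subseteq> V \<and> card e = 2)"

definition edge_coloring :: "'v set set \<Rightarrow> nat \<Rightarrow> ('v set \<Rightarrow> nat) \<Rightarrow> bool" where
  "edge_coloring E r c \<longleftrightarrow> c ` E \<subseteq> {1..r}"

definition proper_edge_coloring :: "'v set set \<Rightarrow> nat \<Rightarrow> ('v set \<Rightarrow> nat) \<Rightarrow> bool" where
  "proper_edge_coloring E r c \<longleftrightarrow>
     edge_coloring E r c \<and> (\<forall>e\<in>E. \<forall>f\<in>E. e \<noteq> f \<and> e \<inter> f \<noteq> {} \<longrightarrow> c e \<noteq> c f)"

definition color_degree :: "'v set set \<Rightarrow> ('v set \<Rightarrow> nat) \<Rightarrow> 'v \<Rightarrow> nat" where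
  "color_degree E c v = card (c ` {e\<in>E. v \<in> e})"

definition total_color_degree :: "'v set \<Rightarrow> 'v set set \<Rightarrow> ('v set \<Rightarrow> nat) \<Rightarrow> nat" where
  "total_color_degree V E c = (\<Sum>v\<in>V. color_degree E c v)"

(* Finiteness is stated explicitly because card is 0 on infinite sets. *)
definition matching :: "'v set set \<Rightarrow> nat \<Rightarrow> 'v set set \<Rightarrow> bool" where
  "matching E k M \<longleftrightarrow> M \<subseteq> E \<and> finite M \<and> card M = k \<and> disjoint M"

definition rainbow :: "('v set \<Rightarrow> nat) \<Rightarrow> 'v set set \<Rightarrow> bool" where
  "rainbow c M \<longleftrightarrow> inj_on c M"

end

theory Submission
  imports Defs
begin

text \<open>Since the colour degree is at most the degree, \<open>G\<close> has at least \<open>m n\<close> edges. By induction on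
  \<open>m\<close>, keeping the vertex set fixed, every properly coloured graph with at least \<open>m n\<close> edges has a
  rainbow matching of size \<open>m\<close>. It suffices to delete at most \<open>n\<close> edges so that every rainbow
  matching of size \<open>m - 1\<close> in the rest extends by one edge. If a vertex has degree above
  \<open>3 (m - 1)\<close>, delete its edges; if a colour has more than \<open>2 (m - 1)\<close> edges, delete that colour; in
  both cases too few of the deleted edges are blocked. Otherwise delete everything in conflict with
  one arbitrary edge, which is at most \<open>8 (m - 1) \<le> n\<close> edges.\<close>

lemma simple_graph_mono: "simple_graph V E \<Longrightarrow> F \<subseteq> E \<Longrightarrow> simple_graph V F"
  unfolding simple_graph_def by blast

lemma proper_edge_coloring_mono:
  "proper_edge_coloring E r c \<Longrightarrow> F \<subseteq> E \<Longrightarrow> proper_edge_coloring F r c"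
  unfolding proper_edge_coloring_def edge_coloring_def by blast

lemma simple_graph_finite_edges: "simple_graph V E \<Longrightarrow> finite E"
  unfolding simple_graph_def by (meson finite_Pow_iff finite_subset PowI subsetI)

lemma simple_graph_edge_containing:
  assumes "simple_graph V E" "e \<in> E" "v \<in> e"
  obtains w where "w \<in> V" "e = {v, w}"
proof -
  have "card e = 2" "e \<subseteq> V" using assms unfolding simple_graph_def by auto
  then show thesis using that assms(3) by (auto simp: card_2_iff)
qed

lemma card_star_le:
  assumes "simple_graph V E"
  shows "card {e\<in>E. v \<in> e} \<le> card V"
proof -
  have "finite V" using assms by (simp add: simple_graph_def)
  moreover have "{e\<in>E. v \<in> e} \<subseteq> (\<lambda>w. {v, w}) ` V"
    using simple_graph_edge_containing[OF assms] by blast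
  ultimately show ?thesis by (rule surj_card_le)
qed

lemma sum_degree:
  assumes "simple_graph V E"
  shows "(\<Sum>v\<in>V. card {e\<in>E. v \<in> e}) = 2 * card E"
proof -
  have fin: "finite V" "finite E"
    using assms simple_graph_finite_edges by (auto simp: simple_graph_def)
  show ?thesis
  proof (rule sum_multicount[OF fin])
    show "\<forall>e\<in>E. card {v\<in>V. v \<in> e} = 2"
    proof
      fix e assume "e \<in> E"
      then have "e \<subseteq> V" "card e = 2" using assms by (auto simp: simple_graph_def)
      moreover from this have "{v\<in>V. v \<in> e} = e" by blast
      ultimately show "card {v\<in>V. v \<in> e} = 2" by simp
    qed
  qed
qed

text \<open>A vertex sees at most as many colours as it has incident edges, and the degrees sum to
  \<open>2 * card E\<close>. This turns the hypothesis on colour degrees into a bound on the number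
  of edges.\<close>

lemma total_color_degree_le:
  assumes "simple_graph V E"
  shows "total_color_degree V E c \<le> 2 * card E"
  unfolding total_color_degree_def color_degree_def sum_degree[OF assms, symmetric]
  using simple_graph_finite_edges[OF assms] by (intro sum_mono card_image_le) simp

lemma card_Union_matching:
  assumes "simple_graph V E" "matching E k M"
  shows "finite (\<Union>M)" "card (\<Union>M) = 2 * k"
proof -
  have M: "M \<subseteq> E" "card M = k" "disjoint M" using assms(2) by (auto simp: matching_def)
  have e: "card e = 2" "finite e" if "e \<in> M" for e
    using that M(1) assms(1) by (auto simp: simple_graph_def intro: finite_subset)
  show "finite (\<Union>M)" using assms(2) e by (auto simp: matching_def)
  show "card (\<Union>M) = 2 * k"
    using card_Union_disjoint[of M] M e by (simp add: disjoint_def pairwise_def disjnt_def)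
qed

lemma matching_color_class:
  assumes "simple_graph V E" "proper_edge_coloring E r c"
  shows "matching E (card {e\<in>E. c e = a}) {e\<in>E. c e = a}"
  using assms simple_graph_finite_edges[OF assms(1)]
  by (auto simp: matching_def disjoint_def proper_edge_coloring_def)

text \<open>By properness a colour class is a matching, so it covers twice as many vertices as it
  has edges. The weaker bound stated here is what deleting a whole colour requires.\<close>

lemma card_color_class_le:
  assumes "simple_graph V E" "proper_edge_coloring E r c"
  shows "card {e\<in>E. c e = a} \<le> card V"
proof -
  have "finite V" "\<Union>{e\<in>E. c e = a} \<subseteq> V" using assms(1) by (auto simp: simple_graph_def)
  then have "card (\<Union>{e\<in>E. c e = a}) \<le> card V" by (rule card_mono)
  then show ?thesis
    using card_Union_matching(2)[OF assms(1) matching_color_class[OF assms]] by simp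
qed

lemma rainbow_matching_insert:
  assumes "matching E k M" "rainbow c M" "e \<in> E" "e \<noteq> {}" "e \<inter> \<Union>M = {}" "c e \<notin> c ` M"
  shows "matching E (Suc k) (insert e M) \<and> rainbow c (insert e M)"
proof -
  have "e \<notin> M" using assms(6) by blast
  moreover have "disjoint (insert e M)"
    using assms(1,5) unfolding matching_def disjoint_def by blast
  ultimately show ?thesis using assms unfolding matching_def rainbow_def by auto
qed

text \<open>At most \<open>k\<close> edges at \<open>v\<close> repeat a colour of \<open>M\<close>,
  and at most \<open>2 * k\<close> of them meet a vertex covered by \<open>M\<close>. More than
  \<open>3 * k\<close> edges at \<open>v\<close> therefore leave one that is not blocked.\<close>

lemma star_edge_extending:
  assumes G: "simple_graph V E" "proper_edge_coloring E r c"
    and M: "matching E k M" "v \<notin> \<Union>M"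
    and deg: "3 * k < card {e\<in>E. v \<in> e}"
  obtains e where "e \<in> E" "e \<inter> \<Union>M = {}" "c e \<notin> c ` M"
proof -
  define S where "S = {e\<in>E. v \<in> e}"
  define A where "A = {e\<in>S. c e \<in> c ` M}"
  define B where "B = {e\<in>S. e \<inter> \<Union>M \<noteq> {}}"
  have finM: "finite M" "card M = k" using M(1) by (auto simp: matching_def)
  have finS: "finite S" using simple_graph_finite_edges[OF G(1)] by (simp add: S_def)
  \<comment> \<open>All edges in \<open>A\<close> share the vertex \<open>v\<close>, so properness
    gives them distinct colours.\<close>
  have "inj_on c A"
    using G(2) by (auto simp: A_def S_def inj_on_def proper_edge_coloring_def)
  then have "card A \<le> card (c ` M)"
    by (rule card_inj_on_le) (use finM in \<open>auto simp: A_def\<close>)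
  also have "\<dots> \<le> k" using finM card_image_le by blast
  finally have A: "card A \<le> k" .
  have "B \<subseteq> (\<lambda>w. {v, w}) ` \<Union>M"
  proof
    fix e assume "e \<in> B"
    then have e: "e \<in> E" "v \<in> e" "e \<inter> \<Union>M \<noteq> {}" by (auto simp: B_def S_def)
    obtain w where "e = {v, w}" using simple_graph_edge_containing[OF G(1) e(1,2)] .
    \<comment> \<open>As \<open>M\<close> misses \<open>v\<close>, the edge can meet
      \<open>M\<close> only in its other end \<open>w\<close>, which determines the edge.\<close>
    then show "e \<in> (\<lambda>w. {v, w}) ` \<Union>M" using e(3) M(2) by auto
  qed
  then have B: "card B \<le> 2 * k"
    using surj_card_le card_Union_matching[OF G(1) M(1)] by metis
  have "\<not> S \<subseteq> A \<union> B"
  proof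
    assume "S \<subseteq> A \<union> B"
    then have "card S \<le> card (A \<union> B)"
      by (rule card_mono[rotated]) (use finS in \<open>simp add: A_def B_def\<close>)
    also have "\<dots> \<le> card A + card B" by (rule card_Un_le)
    finally show False using A B deg by (simp add: S_def)
  qed
  then show thesis using that unfolding A_def B_def S_def by blast
qed

text \<open>Each of the \<open>2 * k\<close> vertices covered by \<open>M\<close> lies on at most
  one edge of colour \<open>a\<close>, so \<open>M\<close> blocks at most \<open>2 * k\<close> edges
  of the class. That \<open>a\<close> is absent from \<open>M\<close> is left to the place of
  use.\<close>

lemma color_class_edge_extending:
  assumes G: "simple_graph V E" "proper_edge_coloring E r c"
    and M: "matching E k M"
    and large: "2 * k < card {e\<in>E. c e = a}"
  obtains e where "e \<in> E" "c e = a" "e \<inter> \<Union>M = {}"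
proof -
  define C where "C = {e\<in>E. c e = a}"
  have finC: "finite C" using simple_graph_finite_edges[OF G(1)] by (simp add: C_def)
  note U = card_Union_matching[OF G(1) M]
  have le1: "card {e\<in>C. w \<in> e} \<le> 1" for w
  proof -
    have "e = f" if "e \<in> C" "w \<in> e" "f \<in> C" "w \<in> f" for e f
      using G(2) that unfolding C_def proper_edge_coloring_def by blast
    then show ?thesis using finC by (simp add: card_le_Suc0_iff_eq)
  qed
  have "\<not> C \<subseteq> (\<Union>w\<in>\<Union>M. {e\<in>C. w \<in> e})"
  proof
    assume "C \<subseteq> (\<Union>w\<in>\<Union>M. {e\<in>C. w \<in> e})"
    then have "card C \<le> card (\<Union>w\<in>\<Union>M. {e\<in>C. w \<in> e})"
      by (rule card_mono[rotated]) (rule finite_UN_I[OF U(1)], simp add: finC)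
    also have "\<dots> \<le> (\<Sum>w\<in>\<Union>M. card {e\<in>C. w \<in> e})" using U(1) by (rule card_UN_le)
    also have "\<dots> \<le> (\<Sum>w\<in>\<Union>M. 1)" by (intro sum_mono le1)
    finally show False using U(2) large by (simp add: C_def)
  qed
  then obtain e where "e \<in> C" "e \<inter> \<Union>M = {}" by blast
  then show thesis using that unfolding C_def by blast
qed

text \<open>The two stars and the colour class contribute 3k + 3k + 2k edges; this is the origin of
  the constant 8.\<close>

lemma card_conflicts_le:
  assumes "\<And>v. card {e\<in>E. v \<in> e} \<le> 3 * k" "\<And>a. card {e\<in>E. c e = a} \<le> 2 * k"
  shows "card {e\<in>E. u \<in> e \<or> v \<in> e \<or> c e = a} \<le> 8 * k"
proof -
  have "{e\<in>E. u \<in> e \<or> v \<in> e \<or> c e = a} = {e\<in>E. u \<in> e} \<union> {e\<in>E. v \<in> e} \<union> {e\<in>E. c e = a}"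
    by blast
  also have "card \<dots> \<le> card {e\<in>E. u \<in> e} + card {e\<in>E. v \<in> e} + card {e\<in>E. c e = a}"
    by (meson add_le_mono1 card_Un_le le_trans)
  also have "\<dots> \<le> 8 * k" using assms(1)[of u] assms(1)[of v] assms(2)[of a] by linarith
  finally show ?thesis .
qed

text \<open>The set \<open>D\<close> is fixed before \<open>M\<close> is known. Only
  \<open>M\<close> has to avoid \<open>D\<close>; the extending edge is taken from \<open>E\<close>
  and may lie in \<open>D\<close>.\<close>

lemma removable_edges:
  assumes G: "simple_graph V E" "proper_edge_coloring E r c"
    and "E \<noteq> {}" and k: "8 * k \<le> card V"
  obtains D where "D \<subseteq> E" "card D \<le> card V"
    and "\<And>M. matching (E - D) k M \<Longrightarrow> \<exists>e\<in>E. e \<inter> \<Union>M = {} \<and> c e \<notin> c ` M"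
proof -
  have lift: "matching E k M" if "matching (E - D) k M" for D M
    using that by (auto simp: matching_def)
  consider (star) v where "3 * k < card {e\<in>E. v \<in> e}"
    | (abundant) a where "2 * k < card {e\<in>E. c e = a}"
    | (sparse) "\<And>v. card {e\<in>E. v \<in> e} \<le> 3 * k" "\<And>a. card {e\<in>E. c e = a} \<le> 2 * k"
    by (meson not_le)
  then show thesis
  proof cases
    case star
    show thesis
    proof (rule that[of "{e\<in>E. v \<in> e}"])
      fix M assume M: "matching (E - {e\<in>E. v \<in> e}) k M"
      then have "v \<notin> \<Union>M" by (auto simp: matching_def)
      from star_edge_extending[OF G lift[OF M] this star]
      show "\<exists>e\<in>E. e \<inter> \<Union>M = {} \<and> c e \<notin> c ` M" by metis
    qed (use card_star_le[OF G(1)] in auto)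
  next
    case abundant
    show thesis
    proof (rule that[of "{e\<in>E. c e = a}"])
      fix M assume M: "matching (E - {e\<in>E. c e = a}) k M"
      then have "a \<notin> c ` M" by (auto simp: matching_def)
      then show "\<exists>e\<in>E. e \<inter> \<Union>M = {} \<and> c e \<notin> c ` M"
        using color_class_edge_extending[OF G lift[OF M] abundant] by metis
    qed (use card_color_class_le[OF G] in auto)
  next
    case sparse
    obtain e where e: "e \<in> E" using \<open>E \<noteq> {}\<close> by blast
    then have "card e = 2" using G(1) by (simp add: simple_graph_def)
    then obtain u v where uv: "e = {u, v}" by (auto simp: card_2_iff)
    show thesis
    proof (rule that[of "{f\<in>E. u \<in> f \<or> v \<in> f \<or> c f = c e}"])
      show "card {f\<in>E. u \<in> f \<or> v \<in> f \<or> c f = c e} \<le> card V"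
        using card_conflicts_le[OF sparse] k by (rule le_trans)
      fix M assume "matching (E - {f\<in>E. u \<in> f \<or> v \<in> f \<or> c f = c e}) k M"
      \<comment> \<open>Every edge at \<open>u\<close> or \<open>v\<close> and every edge coloured
        like \<open>e\<close> has been deleted, so the single edge \<open>e\<close> extends all such
        \<open>M\<close>.\<close>
      then have "e \<inter> \<Union>M = {}" "c e \<notin> c ` M" by (auto simp: matching_def uv)
      then show "\<exists>e\<in>E. e \<inter> \<Union>M = {} \<and> c e \<notin> c ` M" using e by blast
    qed auto
  qed
qed

lemma rainbow_matching_of_many_edges:
  assumes "simple_graph V E" "proper_edge_coloring E r c"
    and "8 * m \<le> card V" "m * card V \<le> card E"
  shows "\<exists>M. matching E m M \<and> rainbow c M"
  using assms
proof (induction m arbitrary: E)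
  case 0
  then show ?case by (intro exI[of _ "{}"]) (simp add: matching_def rainbow_def)
next
  case (Suc k)
  note G = Suc.prems(1,2)
  \<comment> \<open>The bound \<open>8 * Suc k \<le> card V\<close> forces \<open>V\<close> to be
    nonempty, so the edge bound yields an edge, as \<open>removable_edges\<close> requires.\<close>
  have "0 < Suc k * card V" using Suc.prems(3) by simp
  then have "E \<noteq> {}" using Suc.prems(4) by auto
  then obtain D where D: "D \<subseteq> E" "card D \<le> card V"
    and ext: "\<And>M. matching (E - D) k M \<Longrightarrow> \<exists>e\<in>E. e \<inter> \<Union>M = {} \<and> c e \<notin> c ` M"
    using removable_edges[OF G, of k] Suc.prems(3) by auto
  have "card (E - D) = card E - card D"
    using D(1) simple_graph_finite_edges[OF G(1)] by (meson card_Diff_subset finite_subset)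
  \<comment> \<open>Deleting at most \<open>card V\<close> edges lowers the factor of
    \<open>card V\<close> by exactly one, as the induction hypothesis needs.\<close>
  then have "k * card V \<le> card (E - D)" using D(2) Suc.prems(4) by simp
  then obtain M where M: "matching (E - D) k M" "rainbow c M"
    using Suc.IH[of "E - D"] simple_graph_mono[OF G(1)] proper_edge_coloring_mono[OF G(2)]
      Suc.prems(3) by auto
  obtain e where e: "e \<in> E" "e \<inter> \<Union>M = {}" "c e \<notin> c ` M" using ext[OF M(1)] by blast
  have "e \<noteq> {}" using e(1) G(1) by (auto simp: simple_graph_def)
  moreover have "matching E k M" using M(1) by (auto simp: matching_def)
  ultimately show ?case using rainbow_matching_insert M(2) e by metis
qed

theorem theorem3:
  fixes V :: "'v set" and E :: "'v set set" and c :: "'v set \<Rightarrow> nat" and m n r :: nat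
  assumes "simple_graph V E"
    and "card V = n"
    and "n \<ge> 8 * m"
    and "proper_edge_coloring E r c"
    and "total_color_degree V E c \<ge> 2 * m * n"
  shows "\<exists>M. matching E m M \<and> rainbow c M"
proof (rule rainbow_matching_of_many_edges)
  show "m * card V \<le> card E"
    using total_color_degree_le[OF assms(1), of c] assms(2,5) by simp
qed (use assms in auto)

end
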